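(* Let $\mathcal{A}$ be an algebra of linear operators acting in the linear space $\mathbb{P}$ of polynomials, and let $(p_n)_{n\ge 0}$ be a sequence of polynomials with $\deg p_n=n$. Assume that there is an operator $D_p\in\mathcal{A}$ with $D_p(p_n)=np_n$ for all $n\ge 0$. Let $m\ge 1$ and let $(\varepsilon^1_n)_n,\ldots,(\varepsilon^m_n)_n$ be $m$ sequences of numbers which define $m$ $\mathcal{D}$-operators $\mathcal{D}_1,\ldots,\mathcal{D}_m$ (not necessarily different) for $(p_n)_n$ and $\mathcal{A}$, i.e. the linear operators determined by $$\mathcal{D}_h(p_n)=\sum_{j=1}^n(-1)^{j+1}\varepsilon_n^h\cdots\varepsilon_{n-j+1}^h\,p_{n-j},\quad n\ge0,$$ belong to $\mathcal{A}$ for $h=1,\ldots,m$. Assume that for each $h$ the sequence $(\varepsilon^h_n)_n$ is a rational function in $n$ which (is defined and) does not vanish for $n\in\mathbb{Z}$. Let $R_1,\ldots,R_m$ be arbitrary polynomials such that $\Omega(n)\neq0$ for all $n\ge0$, where $$\Omega(x)=\det\left(\xi^l_{x-j,m-j}R_l(x-j)\right)_{l,j=1}^m .$$ Consider the sequence of polynomials $(q_n)_{n\ge0}$ defined by $$q_n(x)=\begin{vmatrix} p_n(x)&-p_{n-1}(x)&\cdots&(-1)^mp_{n-m}(x)\\ \xi^1_{n,m}R_1(n)&\xi^1_{n-1,m-1}R_1(n-1)&\cdots&R_1(n-m)\\ \vdots&\vdots&\ddots&\vdots\\ \xi^m_{n,m}R_m(n)&\xi^m_{n-1,m-1}R_m(n-1)&\cdots&R_m(n-m)\end{vmatrix}.$$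 For a rational function $S$ and $h=1,\ldots,m$, define $$M_h(x)=\sum_{j=1}^m(-1)^{h+j}\xi^h_{x,m-j}S(x+j)\det\left(\xi^l_{x-r,m-j-r}R_l(x-r)\right)_{l\in\{1,\ldots,m\}\setminus\{h\},\ r\in\{-j+1,-j+2,\ldots,m-j\}\setminus\{0\}}.$$ Assume that $S(x)\Omega(x)$ and $M_h(x)$, $h=1,\ldots,m$, are polynomials in $x$. Let $P_S$ be a polynomial with $$P_S(x)-P_S(x-1)=S(x)\Omega(x),$$ and define the operator $$D_{q,S}=P_S(D_p)+\sum_{h=1}^mM_h(D_p)\,\mathcal{D}_h\,R_h(D_p).$$ Then $D_{q,S}\in\mathcal{A}$ and $$D_{q,S}(q_n)=P_S(n)\,q_n,\quad n\ge0.$$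
   Context: Conventions: $p_n=0$ for $n<0$. For a linear operator $D:\mathbb{P}\to\mathbb{P}$ and a polynomial $P(x)=\sum_{j=0}^ka_jx^j$, $P(D)=\sum_{j=0}^ka_jD^j$, with $D^0$ the identity; the algebra $\mathcal{A}$ contains the identity. For $h=1,\ldots,m$ and $i\in\mathbb{Z}$ the auxiliary functions $\xi^h_{x,i}$ are defined by $$\xi^h_{x,i}=\prod_{j=0}^{i-1}\varepsilon^h_{x-j}\ (i\ge1),\qquad \xi^h_{x,0}=1,\qquad \xi^h_{x,i}=\frac{1}{\xi^h_{x-i,-i}}\ (i\le-1),$$ where $\varepsilon^h_x$ denotes the rational function giving the sequence $(\varepsilon^h_n)_n$. In the determinant defining $M_h$, the row index $l$ and the column index $r$ are taken in increasing order; for $m=1$ the (empty) determinant equals $1$. *)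

theory Defs
  imports "HOL-Computational_Algebra.Computational_Algebra" "Jordan_Normal_Form.Determinant"
begin

text \<open>Rational functions in one variable are elements of the fraction field of the polynomial
  ring, so identities between them are identities of formal fractions and no convention about
  the value at a pole enters. \<open>rf_shift c r\<close> is \<open>r(x + c)\<close>.\<close>

lemma pcompose_linear_eq_0_iff:
  fixes p :: "'a::idom poly"
  shows "pcompose p [:c, 1:] = 0 \<longleftrightarrow> p = 0"
  by (auto dest: pcompose_eq_0)

definition rf_shift :: "'a::field \<Rightarrow> 'a poly fract \<Rightarrow> 'a poly fract" where
  "rf_shift c r = (THE s. \<exists>a b. b \<noteq> 0 \<and> r = Fract a b \<and>
     s = Fract (pcompose a [:c, 1:]) (pcompose b [:c, 1:]))"

lemma rf_shift_Fract:
  assumes "b \<noteq> 0"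
  shows "rf_shift c (Fract a b) = Fract (pcompose a [:c, 1:]) (pcompose b [:c, 1:])"
  unfolding rf_shift_def
proof (rule the_equality)
  show "\<exists>u v. v \<noteq> 0 \<and> Fract a b = Fract u v \<and>
      Fract (pcompose a [:c, 1:]) (pcompose b [:c, 1:]) =
      Fract (pcompose u [:c, 1:]) (pcompose v [:c, 1:])"
    using assms by blast
next
  fix s assume "\<exists>u v. v \<noteq> 0 \<and> Fract a b = Fract u v \<and>
      s = Fract (pcompose u [:c, 1:]) (pcompose v [:c, 1:])"
  then obtain u v where uv: "v \<noteq> 0" "Fract a b = Fract u v"
      "s = Fract (pcompose u [:c, 1:]) (pcompose v [:c, 1:])"
    by blast
  have "u * b = a * v" using uv(1,2) assms by (simp add: eq_fract)
  then have "pcompose u [:c, 1:] * pcompose b [:c, 1:] = pcompose a [:c, 1:] * pcompose v [:c, 1:]"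
    by (metis pcompose_mult)
  then show "s = Fract (pcompose a [:c, 1:]) (pcompose b [:c, 1:])"
    using uv assms by (simp add: eq_fract pcompose_linear_eq_0_iff)
qed

definition rf_defined_at :: "'a::field poly fract \<Rightarrow> 'a \<Rightarrow> bool" where
  "rf_defined_at r x \<longleftrightarrow> (\<exists>a b. r = Fract a b \<and> poly b x \<noteq> 0)"

text \<open>The value at a point; meaningful only where \<open>rf_defined_at\<close> holds.\<close>

definition rf_eval :: "'a::field poly fract \<Rightarrow> 'a \<Rightarrow> 'a" where
  "rf_eval r x = (THE v. \<exists>a b. r = Fract a b \<and> poly b x \<noteq> 0 \<and> v = poly a x / poly b x)"

lemma rf_eval_Fract:
  assumes "poly b x \<noteq> 0"
  shows "rf_eval (Fract a b) x = poly a x / poly b x"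
  unfolding rf_eval_def
proof (rule the_equality)
  show "\<exists>c d. Fract a b = Fract c d \<and> poly d x \<noteq> 0 \<and> poly a x / poly b x = poly c x / poly d x"
    using assms by blast
next
  fix v assume "\<exists>c d. Fract a b = Fract c d \<and> poly d x \<noteq> 0 \<and> v = poly c x / poly d x"
  then obtain c d where cd: "Fract a b = Fract c d" "poly d x \<noteq> 0" "v = poly c x / poly d x"
    by blast
  have "b \<noteq> 0" "d \<noteq> 0" using assms cd(2) by auto
  then have "a * d = c * b" using cd(1) by (simp add: eq_fract)
  then have "poly a x * poly d x = poly c x * poly b x" by (metis poly_mult)
  then show "v = poly a x / poly b x" using assms cd(2,3) by (simp add: frac_eq_eq)
qed

definition operator_algebra :: "('a::field poly \<Rightarrow> 'a poly) set \<Rightarrow> bool" where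
  "operator_algebra A \<longleftrightarrow>
     (\<forall>T\<in>A. Vector_Spaces.linear Polynomial.smult Polynomial.smult T) \<and>
     (\<lambda>f. f) \<in> A \<and>
     (\<forall>T\<in>A. \<forall>U\<in>A. (\<lambda>f. T f + U f) \<in> A) \<and>
     (\<forall>c. \<forall>T\<in>A. (\<lambda>f. Polynomial.smult c (T f)) \<in> A) \<and>
     (\<forall>T\<in>A. \<forall>U\<in>A. T \<circ> U \<in> A)"

definition poly_op :: "'a::field poly \<Rightarrow> ('a poly \<Rightarrow> 'a poly) \<Rightarrow> 'a poly \<Rightarrow> 'a poly" where
  "poly_op P D f = (\<Sum>j\<le>degree P. Polynomial.smult (coeff P j) ((D ^^ j) f))"

text \<open>The \<open>\<D>\<close>-operator of a sequence \<open>eps\<close> for \<open>p\<close> and \<open>A\<close>. Since \<open>deg p\<^sub>n = n\<close> in all uses,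
  the \<open>p\<^sub>n\<close> form a basis and \<open>T\<close> is determined by the values prescribed here.\<close>

definition D_operator ::
  "('a::field poly \<Rightarrow> 'a poly) set \<Rightarrow> (nat \<Rightarrow> 'a poly) \<Rightarrow> (nat \<Rightarrow> 'a) \<Rightarrow> ('a poly \<Rightarrow> 'a poly) \<Rightarrow> bool"
where
  "D_operator A p eps T \<longleftrightarrow> T \<in> A \<and> Vector_Spaces.linear Polynomial.smult Polynomial.smult T \<and>
     (\<forall>n. T (p n) = (\<Sum>j=1..n. Polynomial.smult ((-1) ^ (j + 1) * (\<Prod>i<j. eps (n - i))) (p (n - j))))"

text \<open>\<open>xi e i\<close> is the rational function \<open>\<xi>\<^bsub>x,i\<^esub>\<close> of \<open>x\<close> attached to the rational function
  \<open>e\<close> (i.e. \<open>\<epsilon>\<^sub>x\<close>).\<close>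

definition xi_nat :: "'a::field poly fract \<Rightarrow> nat \<Rightarrow> 'a poly fract" where
  "xi_nat e i = (\<Prod>j<i. rf_shift (- of_nat j) e)"

definition xi :: "'a::field poly fract \<Rightarrow> int \<Rightarrow> 'a poly fract" where
  "xi e i = (if i \<ge> 0 then xi_nat e (nat i) else 1 / rf_shift (of_int (- i)) (xi_nat e (nat (- i))))"

text \<open>The rational function \<open>\<xi>\<^bsub>x-s,i\<^esub> R(x - s)\<close>.\<close>

definition xiR :: "'a::field poly fract \<Rightarrow> 'a poly \<Rightarrow> int \<Rightarrow> int \<Rightarrow> 'a poly fract" where
  "xiR e R s i = rf_shift (- of_int s) (xi e i) * rf_shift (- of_int s) (to_fract R)"

text \<open>Families indexed by \<open>1, \<dots>, m\<close> are functions on \<open>nat\<close>, whereas rows and columns of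
  matrices are numbered from \<open>0\<close>.\<close>

definition Omega :: "nat \<Rightarrow> (nat \<Rightarrow> 'a::field poly fract) \<Rightarrow> (nat \<Rightarrow> 'a poly) \<Rightarrow> 'a poly fract" where
  "Omega m E R = det (mat m m (\<lambda>(a, b).
     let l = a + 1; j = int b + 1 in xiR (E l) (R l) j (int m - j)))"

definition Mfun ::
  "nat \<Rightarrow> (nat \<Rightarrow> 'a::field poly fract) \<Rightarrow> (nat \<Rightarrow> 'a poly) \<Rightarrow> 'a poly fract \<Rightarrow> nat \<Rightarrow> 'a poly fract"
where
  "Mfun m E R S h = (\<Sum>j=1..m. (-1) ^ (h + j) * xi (E h) (int m - int j) * rf_shift (of_nat j) S *
     det (mat (m - 1) (m - 1) (\<lambda>(a, b).
       let l = filter (\<lambda>l. l \<noteq> h) [1..<m + 1] ! a;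
           r = filter (\<lambda>r. r \<noteq> 0) [1 - int j..int m - int j] ! b
       in xiR (E l) (R l) r (int m - int j - r))))"

definition pZ :: "(nat \<Rightarrow> 'a::field poly) \<Rightarrow> int \<Rightarrow> 'a poly" where
  "pZ p k = (if k < 0 then 0 else p (nat k))"

text \<open>Row \<open>0\<close> holds polynomials; the other rows hold numbers, embedded as constants.\<close>

definition q_poly ::
  "nat \<Rightarrow> (nat \<Rightarrow> 'a::field poly) \<Rightarrow> (nat \<Rightarrow> 'a poly fract) \<Rightarrow> (nat \<Rightarrow> 'a poly) \<Rightarrow> nat \<Rightarrow> 'a poly"
where
  "q_poly m p E R n = det (mat (m + 1) (m + 1) (\<lambda>(l, j).
     if l = 0 then (-1) ^ j * pZ p (int n - int j)
     else [: rf_eval (xi (E l) (int m - int j)) (of_int (int n - int j))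
             * poly (R l) (of_int (int n - int j)) :]))"

definition D_qS ::
  "nat \<Rightarrow> ('a::field poly \<Rightarrow> 'a poly) \<Rightarrow> (nat \<Rightarrow> 'a poly \<Rightarrow> 'a poly) \<Rightarrow> (nat \<Rightarrow> 'a poly) \<Rightarrow>
   (nat \<Rightarrow> 'a poly) \<Rightarrow> 'a poly \<Rightarrow> 'a poly \<Rightarrow> 'a poly"
where
  "D_qS m Dp Dop R M P f =
     poly_op P Dp f + (\<Sum>h=1..m. poly_op (M h) Dp (Dop h (poly_op (R h) Dp f)))"

end

theory Submission
  imports Defs
begin

text \<open>Why the theorem holds. Since \<open>\<epsilon>\<^sup>h\<close> has no zeros or poles on the integers, it is a quotient
  \<open>\<epsilon>\<^sup>h\<^sub>k = g\<^sub>h(k) / g\<^sub>h(k - 1)\<close>, so \<open>\<xi>\<^sup>h\<^bsub>k,i\<^esub> = g\<^sub>h(k) / g\<^sub>h(k - i)\<close> at integers. With \<open>f\<^sub>h = g\<^sub>h R\<^sub>h\<close>, the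
  determinants in \<open>\<Omega>\<close>, \<open>M\<^sub>h\<close> and \<open>q\<^sub>n\<close> are all built from the matrices with entries
  \<open>f\<^sub>h(y - c) / g\<^sub>h(y - m)\<close>. Let \<open>b\<^sub>k\<close> be the minor at \<open>y = n\<close> that omits the column \<open>c = k\<close> from
  \<open>c = 0, \<dots>, m\<close>. Then \<open>q\<^sub>n = \<Sum>\<^sub>k b\<^sub>k p\<^bsub>n-k\<^esub>\<close> (\<open>q_poly_expand\<close>), and

  \<open>\<D>\<^sub>h R\<^sub>h(D\<^sub>p) q\<^sub>n = \<Sum>\<^sub>u (-1)\<^bsup>u+1\<^esup> / g\<^sub>h(n - u) \<cdot> (\<Sum>\<^bsub>k<u\<^esub> (-1)\<^sup>k b\<^sub>k f\<^sub>h(n - k)) p\<^bsub>n-u\<^esub>\<close>.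

  The inner sum over all \<open>k \<le> m\<close> is the expansion of a determinant with two proportional rows, so it
  vanishes and \<open>u\<close> runs up to \<open>m\<close> only (\<open>D_operator_q_poly\<close>). Comparing coefficients of \<open>p\<^bsub>n-u\<^esub>\<close>, the
  eigenvalue equation says that \<open>(P\<^sub>S(n) - P\<^sub>S(n - u)) b\<^sub>u\<close> is the sum over \<open>h\<close> of \<open>M\<^sub>h(n - u)\<close> times the
  coefficient above.

  The left side telescopes to \<open>\<Sum>\<^bsub>1\<le>j\<le>u\<^esub> S(y\<^sub>j) \<Omega>(y\<^sub>j) b\<^sub>u\<close> with \<open>y\<^sub>j = n - u + j\<close>. On the right side,
  \<open>M\<^sub>h(n - u)\<close> is a sum over \<open>1 \<le> j \<le> m\<close> of \<open>S(y\<^sub>j)\<close> times a cofactor of the matrix of \<open>\<Omega>(y\<^sub>j)\<close>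
  (\<open>rf_value_Mfun\<close>). Summing over \<open>h\<close> for fixed \<open>j\<close>, cofactor orthogonality leaves \<open>\<Omega>(y\<^sub>j) b\<^sub>u\<close> for
  \<open>j \<le> u\<close> and \<open>0\<close> for \<open>j > u\<close> (\<open>sum_cofactor_partial\<close>), so the two sides agree term by term
  (\<open>telescoped_sum_eq\<close>).

  All of this takes place at integer arguments. The only function that may have poles at integers
  is \<open>S\<close>, and it is evaluated at positive integers only, where \<open>S = (S\<Omega>) / \<Omega>\<close> is defined as \<open>\<Omega>\<close> does
  not vanish.\<close>

section \<open>Values of rational functions\<close>

text \<open>The value of a rational function as a relation rather than a function: each rule below then
  establishes that the compound expression is defined at the point together with its value, and no
  separate side conditions about poles have to be carried along.\<close>

definition rf_value :: "'a::field poly fract \<Rightarrow> 'a \<Rightarrow> 'a \<Rightarrow> bool" where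
  "rf_value r x v \<longleftrightarrow> (\<exists>a b. r = Fract a b \<and> poly b x \<noteq> 0 \<and> v = poly a x / poly b x)"

lemma rf_eval_eqI: "rf_value r x v \<Longrightarrow> rf_eval r x = v"
  unfolding rf_value_def using rf_eval_Fract by blast

lemma rf_value_rf_eval: "rf_defined_at r x \<Longrightarrow> rf_value r x (rf_eval r x)"
  unfolding rf_value_def rf_defined_at_def by (metis rf_eval_Fract)

lemma rf_value_unique: "rf_value r x v \<Longrightarrow> rf_value r x w \<Longrightarrow> v = w"
  using rf_eval_eqI by blast

lemma rf_value_to_fract: "rf_value (to_fract p) x (poly p x)"
  unfolding rf_value_def to_fract_def by (intro exI[of _ p] exI[of _ 1]) simp

lemma rf_value_0: "rf_value 0 x 0"
  and rf_value_1: "rf_value 1 x 1"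
  and rf_value_minus_1: "rf_value (- 1) x (- 1)"
  using rf_value_to_fract[of 0 x] rf_value_to_fract[of 1 x] rf_value_to_fract[of "- 1" x]
  by (simp_all add: to_fract_uminus)

lemma rf_value_add:
  assumes "rf_value r x v" "rf_value s x w"
  shows "rf_value (r + s) x (v + w)"
proof -
  from assms obtain a b c d where *: "r = Fract a b" "poly b x \<noteq> 0" "v = poly a x / poly b x"
    "s = Fract c d" "poly d x \<noteq> 0" "w = poly c x / poly d x"
    unfolding rf_value_def by blast
  then have "b \<noteq> 0" "d \<noteq> 0" by auto
  with * show ?thesis unfolding rf_value_def
    by (intro exI[of _ "a * d + c * b"] exI[of _ "b * d"]) (simp add: add_frac_eq)
qed

lemma rf_value_mult:
  assumes "rf_value r x v" "rf_value s x w"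
  shows "rf_value (r * s) x (v * w)"
proof -
  from assms obtain a b c d where *: "r = Fract a b" "poly b x \<noteq> 0" "v = poly a x / poly b x"
    "s = Fract c d" "poly d x \<noteq> 0" "w = poly c x / poly d x"
    unfolding rf_value_def by blast
  then show ?thesis unfolding rf_value_def
    by (intro exI[of _ "a * c"] exI[of _ "b * d"]) simp
qed

lemma rf_value_divide:
  assumes "rf_value r x v" "rf_value s x w" "w \<noteq> 0"
  shows "rf_value (r / s) x (v / w)"
proof -
  from assms(1,2) obtain a b c d where *: "r = Fract a b" "poly b x \<noteq> 0" "v = poly a x / poly b x"
    "s = Fract c d" "poly d x \<noteq> 0" "w = poly c x / poly d x"
    unfolding rf_value_def by blast
  with assms(3) show ?thesis unfolding rf_value_def
    by (intro exI[of _ "a * d"] exI[of _ "b * c"]) auto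
qed

lemma rf_value_power: "rf_value r x v \<Longrightarrow> rf_value (r ^ n) x (v ^ n)"
  by (induction n) (auto intro: rf_value_mult rf_value_1)

lemma rf_value_sum:
  assumes "\<And>i. i \<in> I \<Longrightarrow> rf_value (r i) x (v i)"
  shows "rf_value (sum r I) x (sum v I)"
  using assms by (induction I rule: infinite_finite_induct)
    (auto intro: rf_value_add rf_value_0)

lemma rf_value_prod:
  assumes "\<And>i. i \<in> I \<Longrightarrow> rf_value (r i) x (v i)"
  shows "rf_value (prod r I) x (prod v I)"
  using assms by (induction I rule: infinite_finite_induct)
    (auto intro: rf_value_mult rf_value_1)

text \<open>The Leibniz formula only uses sums, products and signs, so determinants may be evaluated entry
  by entry.\<close>

lemma rf_value_det:
  assumes "\<And>i j. i < n \<Longrightarrow> j < n \<Longrightarrow> rf_value (f (i, j)) x (g (i, j))"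
  shows "rf_value (det (mat n n f)) x (det (mat n n g))"
proof -
  have "rf_value (signof \<pi> * (\<Prod>i=0..<n. mat n n f $$ (i, \<pi> i))) x
      (signof \<pi> * (\<Prod>i=0..<n. mat n n g $$ (i, \<pi> i)))" if "\<pi> permutes {0..<n}" for \<pi>
  proof (intro rf_value_mult rf_value_prod)
    show "rf_value (signof \<pi>) x (signof \<pi>)"
      by (cases "evenperm \<pi>") (simp_all add: sign_def rf_value_1 rf_value_minus_1)
  next
    fix i assume "i \<in> {0..<n}"
    moreover from this have "\<pi> i < n" using permutes_in_image[OF that, of i] by simp
    ultimately show "rf_value (mat n n f $$ (i, \<pi> i)) x (mat n n g $$ (i, \<pi> i))"
      using assms by simp
  qed
  then show ?thesis
    by (subst (1 2) det_def'[where n = n]) (auto intro!: rf_value_sum)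
qed

lemma rf_value_shift:
  assumes "rf_value r (x + c) v"
  shows "rf_value (rf_shift c r) x v"
proof -
  from assms obtain a b where *: "r = Fract a b" "poly b (x + c) \<noteq> 0"
    "v = poly a (x + c) / poly b (x + c)"
    unfolding rf_value_def by blast
  then have "b \<noteq> 0" by auto
  with * show ?thesis unfolding rf_value_def
    by (intro exI[of _ "pcompose a [:c, 1:]"] exI[of _ "pcompose b [:c, 1:]"])
       (simp add: rf_shift_Fract poly_pcompose add.commute)
qed

section \<open>Minors of scaled Casorati matrices\<close>

text \<open>Both \<open>q\<^sub>n\<close> and the determinants with a repeated row have this shape, one extra row on top of an
  \<open>m \<times> (m + 1)\<close> array; they share the same \<open>m + 1\<close> minors.\<close>

lemma det_border_row:
  fixes C :: "nat \<Rightarrow> nat \<Rightarrow> 'a::comm_ring_1"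
  shows "det (mat (Suc m) (Suc m) (\<lambda>(l, j). if l = 0 then r j else C (l - 1) j)) =
    (\<Sum>k\<le>m. (-1) ^ k * r k * det (mat m m (\<lambda>(a, b). C a (insert_index k b))))"
proof -
  let ?B = "mat (Suc m) (Suc m) (\<lambda>(l, j). if l = 0 then r j else C (l - 1) j)"
  have "det ?B = (\<Sum>k<Suc m. ?B $$ (0, k) * cofactor ?B 0 k)"
    by (rule laplace_expansion_row[where n = "Suc m"]) auto
  also have "\<dots> = (\<Sum>k<Suc m. (-1) ^ k * r k * det (mat m m (\<lambda>(a, b). C a (insert_index k b))))"
  proof (rule sum.cong[OF refl])
    fix k assume k: "k \<in> {..<Suc m}"
    have "mat_delete ?B 0 k = mat m m (\<lambda>(a, b). C a (insert_index k b))"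
      using k by (intro eq_matI) (auto simp: mat_delete_def insert_index_def)
    then show "?B $$ (0, k) * cofactor ?B 0 k =
        (-1) ^ k * r k * det (mat m m (\<lambda>(a, b). C a (insert_index k b)))"
      using k by (simp add: cofactor_def mult_ac)
  qed
  finally show ?thesis by (simp add: lessThan_Suc_atMost)
qed

text \<open>The entries of \<open>adj B \<cdot> B = det B \<cdot> I\<close>.\<close>

lemma sum_cofactor_column:
  fixes B :: "'a::comm_ring_1 mat"
  assumes B: "B \<in> carrier_mat m m" and j: "j < m" and c: "c < m"
  shows "(\<Sum>h<m. cofactor B h j * B $$ (h, c)) = (if c = j then det B else 0)"
proof -
  have "(\<Sum>h<m. cofactor B h j * B $$ (h, c)) = (adj_mat B * B) $$ (j, c)"
    using assms by (auto simp: times_mat_def scalar_prod_def adj_mat_def intro!: sum.cong)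
  also have "\<dots> = (if c = j then det B else 0)"
    using adj_mat(3)[OF B] j c by auto
  finally show ?thesis .
qed

text \<open>For \<open>f\<^sub>a = g\<^sub>a R\<^sub>a\<close> and \<open>\<xi>\<^bsub>y,i\<^esub> = g(y) / g(y - i)\<close>, the entry in the column labelled \<open>c\<close> is
  \<open>\<xi>\<^bsub>y-c,m-c\<^esub> R(y - c)\<close>. Up to the row factors \<open>1 / g\<^sub>a(y - m)\<close> the matrix is a Casorati matrix of the
  sequences \<open>f\<^sub>a\<close>, whose columns are labelled by the backward shifts \<open>0, \<dots>, m\<close>; the argument \<open>c\<close>
  picks \<open>m\<close> of these \<open>m + 1\<close> labels.\<close>

definition casorati_mat :: "nat \<Rightarrow> (nat \<Rightarrow> int \<Rightarrow> 'a::field) \<Rightarrow> (nat \<Rightarrow> int \<Rightarrow> 'a) \<Rightarrow> (nat \<Rightarrow> nat) \<Rightarrow> int \<Rightarrow> 'a mat"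
  where "casorati_mat m f g c y = mat m m (\<lambda>(a, b). f a (y - int (c b)) / g a (y - int m))"

text \<open>Omitting shift \<open>k\<close>. For \<open>k = 0\<close> this is \<open>\<Omega>(y)\<close>, and in general it is the coefficient of
  \<open>p\<^bsub>n-k\<^esub>\<close> in \<open>q\<^sub>n\<close> when \<open>y = n\<close>.\<close>

definition casorati_minor :: "nat \<Rightarrow> (nat \<Rightarrow> int \<Rightarrow> 'a::field) \<Rightarrow> (nat \<Rightarrow> int \<Rightarrow> 'a) \<Rightarrow> nat \<Rightarrow> int \<Rightarrow> 'a"
  where "casorati_minor m f g k y = det (casorati_mat m f g (insert_index k) y)"

lemma insert_index_0: "insert_index 0 = Suc"
  by (auto simp: insert_index_def)

text \<open>Bordering the \<open>m \<times> (m + 1)\<close> array with a copy of its own row \<open>h\<close> gives a singular matrix. This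
  is what makes \<open>\<D>\<^sub>h R\<^sub>h(D\<^sub>p) q\<^sub>n\<close> a combination of \<open>p\<^sub>n, \<dots>, p\<^bsub>n-m\<^esub>\<close> only, and it turns partial sums over
  \<open>k < u\<close> into partial sums over \<open>k \<ge> u\<close>.\<close>

lemma sum_casorati_minor_eq_0:
  fixes f g :: "nat \<Rightarrow> int \<Rightarrow> 'a::field"
  assumes h: "h < m" and g: "g h (n - int m) \<noteq> 0"
  shows "(\<Sum>k\<le>m. (-1) ^ k * casorati_minor m f g k n * f h (n - int k)) = 0"
proof -
  let ?C = "\<lambda>a j. f a (n - int j) / g a (n - int m)"
  let ?B = "mat (Suc m) (Suc m) (\<lambda>(l, j). if l = 0 then ?C h j else ?C (l - 1) j)"
  have "det ?B = 0"
    by (rule det_identical_rows[where n = "Suc m" and i = 0 and j = "Suc h"])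
       (use h in \<open>auto intro!: eq_vecI\<close>)
  then have "(\<Sum>k\<le>m. (-1) ^ k * ?C h k * casorati_minor m f g k n) = 0"
    unfolding det_border_row[of m "?C h" ?C] casorati_minor_def casorati_mat_def .
  then have "(\<Sum>k\<le>m. (-1) ^ k * casorati_minor m f g k n * f h (n - int k)) / g h (n - int m) = 0"
    by (simp add: sum_divide_distrib mult_ac)
  then show ?thesis
    using g by simp
qed

text \<open>Cofactor orthogonality at the point \<open>y\<close>, stated with shifts \<open>1, \<dots>, m\<close> as column labels; hence
  the offset in \<open>j - 1\<close>.\<close>

lemma sum_cofactor_casorati_mat:
  fixes f g :: "nat \<Rightarrow> int \<Rightarrow> 'a::field"
  assumes j: "1 \<le> j" "j \<le> m" and c: "1 \<le> c" "c \<le> m"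
  shows "(\<Sum>h<m. cofactor (casorati_mat m f g Suc y) h (j - 1) * (f h (y - int c) / g h (y - int m))) =
    (if c = j then casorati_minor m f g 0 y else 0)"
proof -
  let ?B = "casorati_mat m f g Suc y"
  have "(\<Sum>h<m. cofactor ?B h (j - 1) * (f h (y - int c) / g h (y - int m))) =
      (\<Sum>h<m. cofactor ?B h (j - 1) * ?B $$ (h, c - 1))"
    using c by (intro sum.cong) (auto simp: casorati_mat_def)
  also have "\<dots> = (if c - 1 = j - 1 then det ?B else 0)"
    by (rule sum_cofactor_column) (use j c in \<open>auto simp: casorati_mat_def\<close>)
  finally show ?thesis
    using j c by (auto simp: casorati_minor_def insert_index_0)
qed

text \<open>The matrices at the two points \<open>n\<close> and \<open>y = n - u + j\<close> have columns in common: shift \<open>k\<close> at \<open>n\<close> is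
  shift \<open>k - u + j\<close> at \<open>y\<close>. The cofactors at \<open>y\<close> of the column with shift \<open>j\<close> annihilate all columns
  with shifts in \<open>1, \<dots>, m\<close> except that one, which corresponds to \<open>k = u\<close>. If \<open>j > u\<close>, all \<open>k < u\<close> give
  shifts in \<open>1, \<dots>, j - 1\<close> and the sum vanishes. If \<open>j \<le> u\<close>, small \<open>k\<close> leave this range; the
  repeated-row identity replaces \<open>k < u\<close> by \<open>u \<le> k \<le> m\<close>, where the shifts are in \<open>j, \<dots>, m\<close> and only
  \<open>k = u\<close> survives.\<close>

lemma sum_cofactor_partial:
  fixes f g :: "nat \<Rightarrow> int \<Rightarrow> 'a::field"
  assumes g: "\<And>h k. h < m \<Longrightarrow> g h k \<noteq> 0"
    and u: "u \<le> m" and j: "1 \<le> j" "j \<le> m" and y: "y = n - int u + int j"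
  shows "(\<Sum>h<m. cofactor (casorati_mat m f g Suc y) h (j - 1) / g h (y - int m) *
      (\<Sum>k<u. (-1) ^ k * casorati_minor m f g k n * f h (n - int k))) =
    (if j \<le> u then (-1) ^ (u + 1) * casorati_minor m f g u n * casorati_minor m f g 0 y else 0)"
proof -
  let ?b = "\<lambda>k. (-1) ^ k * casorati_minor m f g k n"
  let ?c = "\<lambda>h. cofactor (casorati_mat m f g Suc y) h (j - 1) / g h (y - int m)"
  have swap: "(\<Sum>h<m. ?c h * (\<Sum>k\<in>K. ?b k * f h (n - int k))) =
      (\<Sum>k\<in>K. if k = u then ?b u * casorati_minor m f g 0 y else 0)"
    if K: "\<And>k. k \<in> K \<Longrightarrow> u < k + j \<and> k + j \<le> u + m" for K
  proof -
    have "(\<Sum>h<m. ?c h * (\<Sum>k\<in>K. ?b k * f h (n - int k))) =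
        (\<Sum>k\<in>K. ?b k * (\<Sum>h<m. ?c h * f h (n - int k)))"
      unfolding sum_distrib_left by (subst sum.swap) (simp add: mult_ac)
    also have "\<dots> = (\<Sum>k\<in>K. if k = u then ?b u * casorati_minor m f g 0 y else 0)"
    proof (rule sum.cong[OF refl])
      fix k assume "k \<in> K"
      from K[OF this] have c: "1 \<le> k + j - u" "k + j - u \<le> m" "(k + j - u = j) = (k = u)"
        and shift: "n - int k = y - int (k + j - u)"
        using y j by auto
      have "(\<Sum>h<m. ?c h * f h (n - int k)) = (if k = u then casorati_minor m f g 0 y else 0)"
        using sum_cofactor_casorati_mat[OF j c(1,2), of f g y] unfolding shift c(3) by simp
      then show "?b k * (\<Sum>h<m. ?c h * f h (n - int k)) =
          (if k = u then ?b u * casorati_minor m f g 0 y else 0)"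
        by simp
    qed
    finally show ?thesis .
  qed
  show ?thesis
  proof (cases "j \<le> u")
    case True
    have "(\<Sum>k<u. ?b k * f h (n - int k)) = - (\<Sum>k=u..m. ?b k * f h (n - int k))" if "h < m" for h
    proof -
      have "{..m} = {..<u} \<union> {u..m}" "{..<u} \<inter> {u..m} = {}" using u by auto
      then have "(\<Sum>k\<le>m. ?b k * f h (n - int k)) =
          (\<Sum>k<u. ?b k * f h (n - int k)) + (\<Sum>k=u..m. ?b k * f h (n - int k))"
        by (simp add: sum.union_disjoint)
      then show ?thesis
        using sum_casorati_minor_eq_0[of h m g n f] that g by (simp add: eq_neg_iff_add_eq_0)
    qed
    then have "(\<Sum>h<m. ?c h * (\<Sum>k<u. ?b k * f h (n - int k))) =
        - (\<Sum>h<m. ?c h * (\<Sum>k=u..m. ?b k * f h (n - int k)))"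
      by (simp add: sum_negf)
    also have "\<dots> = - (\<Sum>k=u..m. if k = u then ?b u * casorati_minor m f g 0 y else 0)"
      by (subst swap) (use True j u in auto)
    also have "\<dots> = - (?b u * casorati_minor m f g 0 y)"
      using u by simp
    finally show ?thesis using True by simp
  next
    case False
    then have "(\<Sum>h<m. ?c h * (\<Sum>k<u. ?b k * f h (n - int k))) =
        (\<Sum>k<u. if k = u then ?b u * casorati_minor m f g 0 y else 0)"
      by (intro swap) (use j in auto)
    with False show ?thesis by simp
  qed
qed

text \<open>The identity behind the eigenvalue equation. With \<open>M h\<close> the value of \<open>M\<^sub>h\<close> at \<open>x = n - u\<close> and \<open>s\<close>
  the values of \<open>S\<close>, the left side is what the operators \<open>M\<^sub>h(D\<^sub>p) \<D>\<^sub>h R\<^sub>h(D\<^sub>p)\<close> contribute to the coefficient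
  of \<open>p\<^bsub>n-u\<^esub>\<close>; the right side is \<open>(P\<^sub>S(n) - P\<^sub>S(n - u))\<close> times the coefficient of \<open>p\<^bsub>n-u\<^esub>\<close> in \<open>q\<^sub>n\<close>. The
  factor \<open>g h x\<close> of \<open>M h\<close> cancels against the denominator coming from \<open>\<D>\<^sub>h\<close>, after which the sum
  over \<open>h\<close> is evaluated separately for every \<open>j\<close>.\<close>

lemma telescoped_sum_eq:
  fixes f g :: "nat \<Rightarrow> int \<Rightarrow> 'a::field" and s :: "int \<Rightarrow> 'a"
  assumes g: "\<And>h k. h < m \<Longrightarrow> g h k \<noteq> 0" and u: "u \<le> m" and x: "x = n - int u"
    and M: "\<And>h. h < m \<Longrightarrow> M h = (\<Sum>j=1..m. g h x / g h (x + int j - int m) * s (x + int j) *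
      cofactor (casorati_mat m f g Suc (x + int j)) h (j - 1))"
  shows "(\<Sum>h<m. M h * ((-1) ^ (u + 1) / g h x *
      (\<Sum>k<u. (-1) ^ k * casorati_minor m f g k n * f h (n - int k)))) =
    (\<Sum>j=1..u. s (x + int j) * casorati_minor m f g 0 (x + int j)) * casorati_minor m f g u n"
proof -
  let ?t = "\<lambda>h. \<Sum>k<u. (-1) ^ k * casorati_minor m f g k n * f h (n - int k)"
  let ?c = "\<lambda>j h. cofactor (casorati_mat m f g Suc (x + int j)) h (j - 1) / g h (x + int j - int m)"
  have "(\<Sum>h<m. M h * ((-1) ^ (u + 1) / g h x * ?t h)) =
      (\<Sum>h<m. \<Sum>j=1..m. (-1) ^ (u + 1) * s (x + int j) * (?c j h * ?t h))"
  proof (rule sum.cong[OF refl])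
    fix h assume h: "h \<in> {..<m}"
    then have gx: "g h x \<noteq> 0" using g by simp
    have "g h x / g h (x + int j - int m) * s (x + int j) *
        cofactor (casorati_mat m f g Suc (x + int j)) h (j - 1) * ((-1) ^ (u + 1) / g h x * ?t h)
      = (-1) ^ (u + 1) * s (x + int j) * (?c j h * ?t h)" for j
      using gx by simp
    then show "M h * ((-1) ^ (u + 1) / g h x * ?t h) =
        (\<Sum>j=1..m. (-1) ^ (u + 1) * s (x + int j) * (?c j h * ?t h))"
      using M h by (simp only: sum_distrib_right lessThan_iff)
  qed
  also have "\<dots> = (\<Sum>j=1..m. (-1) ^ (u + 1) * s (x + int j) * (\<Sum>h<m. ?c j h * ?t h))"
    by (subst sum.swap) (simp only: sum_distrib_left)
  also have "\<dots> = (\<Sum>j=1..m. if j \<le> u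
      then s (x + int j) * casorati_minor m f g 0 (x + int j) * casorati_minor m f g u n else 0)"
  proof (rule sum.cong[OF refl])
    fix j assume j: "j \<in> {1..m}"
    have "(\<Sum>h<m. ?c j h * ?t h) = (if j \<le> u
        then (-1) ^ (u + 1) * casorati_minor m f g u n * casorati_minor m f g 0 (x + int j) else 0)"
      by (rule sum_cofactor_partial) (use g u j x in auto)
    moreover have "(-1) ^ (u + 1) * (-1) ^ (u + 1) = (1::'a)"
      by (simp flip: power_add mult_2)
    ultimately show "(-1) ^ (u + 1) * s (x + int j) * (\<Sum>h<m. ?c j h * ?t h) = (if j \<le> u
        then s (x + int j) * casorati_minor m f g 0 (x + int j) * casorati_minor m f g u n else 0)"
      by (simp add: mult_ac)
  qed
  also have "\<dots> = (\<Sum>j\<in>{j\<in>{1..m}. j \<le> u}.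
      s (x + int j) * casorati_minor m f g 0 (x + int j) * casorati_minor m f g u n)"
    by (rule sum.inter_filter[symmetric]) simp
  also have "{j\<in>{1..m}. j \<le> u} = {1..u}" using u by auto
  finally show ?thesis by (simp add: sum_distrib_right)
qed

section \<open>Values of the determinants at integers\<close>

text \<open>A solution \<open>g\<close> on the integers, normalised by \<open>g(0) = 1\<close>, of the first-order recurrence
  \<open>g(k) = \<epsilon>\<^sub>k g(k - 1)\<close>. For \<open>k \<ge> 0\<close> the denominator is an empty product, for \<open>k \<le> 0\<close> the
  numerator. Every product of consecutive \<open>\<epsilon>\<close>'s becomes a quotient of two values of \<open>g\<close>.\<close>

definition rf_gauge :: "'a::field_char_0 poly fract \<Rightarrow> int \<Rightarrow> 'a" where
  "rf_gauge e k = (\<Prod>i=1..k. rf_eval e (of_int i)) / (\<Prod>i=k+1..0. rf_eval e (of_int i))"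

definition regular_on_ints :: "'a::field_char_0 poly fract \<Rightarrow> bool" where
  "regular_on_ints e \<longleftrightarrow> (\<forall>k::int. rf_defined_at e (of_int k) \<and> rf_eval e (of_int k) \<noteq> 0)"

lemma regular_on_intsD:
  assumes "regular_on_ints e"
  shows "rf_defined_at e (of_int k)" and "rf_eval e (of_int k) \<noteq> 0"
  using assms by (simp_all add: regular_on_ints_def)

lemma rf_gauge_nonzero: "regular_on_ints e \<Longrightarrow> rf_gauge e k \<noteq> 0"
  by (simp add: rf_gauge_def regular_on_ints_def)

lemma rf_gauge_step:
  assumes "regular_on_ints e"
  shows "rf_gauge e k = rf_eval e (of_int k) * rf_gauge e (k - 1)"
proof (cases "k \<ge> 1")
  case True
  then have "{1..k} = insert k {1..k - 1}" "{k..0} = {}" "{k+1..0} = {}" by auto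
  then show ?thesis by (simp add: rf_gauge_def)
next
  case False
  then have "{k..0} = insert k {k + 1..0}" "{1..k} = {}" "{1..k - 1} = {}" by auto
  moreover have "rf_eval e (of_int k) \<noteq> 0" using assms by (simp add: regular_on_ints_def)
  ultimately show ?thesis by (simp add: rf_gauge_def)
qed

lemma prod_rf_eval_eq_gauge:
  assumes "regular_on_ints e"
  shows "(\<Prod>j<i. rf_eval e (of_int (k - int j))) = rf_gauge e k / rf_gauge e (k - int i)"
proof (induction i)
  case 0
  then show ?case using rf_gauge_nonzero[OF assms] by simp
next
  case (Suc i)
  have "rf_gauge e (k - int i) = rf_eval e (of_int (k - int i)) * rf_gauge e (k - int (Suc i))"
    using rf_gauge_step[OF assms, of "k - int i"] by (simp add: algebra_simps)
  moreover have "rf_eval e (of_int (k - int i)) \<noteq> 0"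
    by (rule regular_on_intsD(2)[OF assms])
  ultimately show ?case using Suc by simp
qed

lemma rf_value_xi:
  assumes "regular_on_ints e" "i \<ge> 0"
  shows "rf_value (xi e i) (of_int k) (rf_gauge e k / rf_gauge e (k - i))"
proof -
  have "rf_value (rf_shift (- of_nat j) e) (of_int k) (rf_eval e (of_int (k - int j)))" for j
    using rf_value_rf_eval[OF regular_on_intsD(1)[OF assms(1), of "k - int j"]]
    by (intro rf_value_shift) simp
  then have "rf_value (xi e i) (of_int k) (\<Prod>j<nat i. rf_eval e (of_int (k - int j)))"
    unfolding xi_def xi_nat_def using assms(2) by (auto intro: rf_value_prod)
  then show ?thesis using prod_rf_eval_eq_gauge[OF assms(1)] assms(2) by simp
qed

text \<open>The sequences \<open>g\<close> and \<open>f = g R\<close> of the Casorati matrices. Matrix rows count from \<open>0\<close> and the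
  families from \<open>1\<close>, hence \<open>Suc a\<close>.\<close>

definition row_scale :: "(nat \<Rightarrow> 'a::field_char_0 poly fract) \<Rightarrow> nat \<Rightarrow> int \<Rightarrow> 'a" where
  "row_scale E a k = rf_gauge (E (Suc a)) k"

definition row_fun ::
  "(nat \<Rightarrow> 'a::field_char_0 poly fract) \<Rightarrow> (nat \<Rightarrow> 'a poly) \<Rightarrow> nat \<Rightarrow> int \<Rightarrow> 'a" where
  "row_fun E R a k = rf_gauge (E (Suc a)) k * poly (R (Suc a)) (of_int k)"

lemma rf_value_xiR:
  assumes "regular_on_ints (E (Suc a))" "i \<ge> 0" and k: "k = x - s" and d: "d = x - s - i"
  shows "rf_value (xiR (E (Suc a)) (R (Suc a)) s i) (of_int x) (row_fun E R a k / row_scale E a d)"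
proof -
  have "rf_value (xiR (E (Suc a)) (R (Suc a)) s i) (of_int x)
    (rf_gauge (E (Suc a)) k / rf_gauge (E (Suc a)) d * poly (R (Suc a)) (of_int k))"
    unfolding xiR_def
    by (intro rf_value_mult rf_value_shift)
       (use rf_value_xi[OF assms(1,2), of k] rf_value_to_fract[of "R (Suc a)" "of_int k"] k d
        in simp_all)
  then show ?thesis by (simp add: row_fun_def row_scale_def)
qed

text \<open>The columns of \<open>\<Omega>\<close> have shifts \<open>1, \<dots>, m\<close>, so it is the minor omitting shift \<open>0\<close>.\<close>

lemma rf_value_Omega:
  assumes "\<And>a. a < m \<Longrightarrow> regular_on_ints (E (Suc a))"
  shows "rf_value (Omega m E R) (of_int y) (casorati_minor m (row_fun E R) (row_scale E) 0 y)"
  unfolding Omega_def casorati_minor_def casorati_mat_def insert_index_0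
  by (rule rf_value_det) (auto simp: Let_def intro!: rf_value_xiR assms)

text \<open>The next two lemmas identify the row and column lists in \<open>M\<^sub>h\<close> with the rows and columns that
  survive when row \<open>h\<close> and shift \<open>j\<close> are deleted: the column index \<open>r\<close> at \<open>x\<close> is the shift \<open>r + j\<close>
  at \<open>x + j\<close>, and \<open>r = 0\<close> is the deleted shift \<open>j\<close>.\<close>

lemma nth_filter_neq_upt:
  assumes "1 \<le> h" "h \<le> m" "a < m - 1"
  shows "filter (\<lambda>l. l \<noteq> h) [1..<m + 1] ! a = Suc (insert_index (h - 1) a)"
proof -
  have "[1..<m + 1] = [1..<h] @ h # [Suc h..<m + 1]"
    using assms upt_add_eq_append[of 1 h "m + 1 - h"] by (simp add: upt_conv_Cons)
  then have "filter (\<lambda>l. l \<noteq> h) [1..<m + 1] = [1..<h] @ [Suc h..<m + 1]"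
    by (auto simp: filter_id_conv simp del: upt_Suc)
  then show ?thesis
    using assms by (auto simp: nth_append insert_index_def)
qed

lemma nth_filter_neq_upto:
  assumes "1 \<le> j" "j \<le> m" "b < m - 1"
  shows "filter (\<lambda>r. r \<noteq> 0) [1 - int j..int m - int j] ! b = int (Suc (insert_index (j - 1) b)) - int j"
proof -
  have "[1 - int j..int m - int j] = [1 - int j..-1] @ 0 # [1..int m - int j]"
    using assms upto_split3[of "1 - int j" 0 "int m - int j"] by simp
  then have "filter (\<lambda>r. r \<noteq> 0) [1 - int j..int m - int j] = [1 - int j..-1] @ [1..int m - int j]"
    by (simp add: filter_id_conv)
  then show ?thesis
    using assms by (auto simp: nth_append insert_index_def nth_upto)
qed

text \<open>The determinant and sign in the \<open>j\<close>-th term of \<open>M\<^sub>h(x)\<close> form a cofactor of the matrix of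
  \<open>\<Omega>(x + j)\<close>, because \<open>\<xi>\<^bsub>x-r,m-j-r\<^esub> = \<xi>\<^bsub>(x+j)-(r+j),m-(r+j)\<^esub>\<close>. Here \<open>h\<close> counts from \<open>0\<close>.\<close>

lemma rf_value_Mfun:
  assumes reg: "\<And>a. a < m \<Longrightarrow> regular_on_ints (E (Suc a))"
    and S: "\<And>j. 1 \<le> j \<Longrightarrow> j \<le> m \<Longrightarrow> rf_value S (of_int (x + int j)) (s (x + int j))"
    and h: "h < m"
  shows "rf_value (Mfun m E R S (Suc h)) (of_int x)
    (\<Sum>j=1..m. row_scale E h x / row_scale E h (x + int j - int m) * s (x + int j) *
      cofactor (casorati_mat m (row_fun E R) (row_scale E) Suc (x + int j)) h (j - 1))"
  unfolding Mfun_def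
proof (rule rf_value_sum)
  fix j assume "j \<in> {1..m}"
  then have j: "1 \<le> j" "j \<le> m" by auto
  let ?F = "casorati_mat m (row_fun E R) (row_scale E) Suc (x + int j)"
  let ?D = "det (mat (m - 1) (m - 1) (\<lambda>(a, b).
       let l = filter (\<lambda>l. l \<noteq> Suc h) [1..<m + 1] ! a;
           r = filter (\<lambda>r. r \<noteq> 0) [1 - int j..int m - int j] ! b
       in xiR (E l) (R l) r (int m - int j - r)))"
  have "mat_delete ?F h (j - 1) = mat (m - 1) (m - 1) (\<lambda>(a, b).
      row_fun E R (insert_index h a) (x + int j - int (Suc (insert_index (j - 1) b)))
      / row_scale E (insert_index h a) (x + int j - int m))"
    using h j by (intro eq_matI) (auto simp: mat_delete_def casorati_mat_def insert_index_def)
  moreover have "rf_value ?D (of_int x) (det (mat (m - 1) (m - 1) (\<lambda>(a, b).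
      row_fun E R (insert_index h a) (x + int j - int (Suc (insert_index (j - 1) b)))
      / row_scale E (insert_index h a) (x + int j - int m))))"
  proof (rule rf_value_det, unfold prod.case Let_def)
    fix a b assume ab: "a < m - 1" "b < m - 1"
    have l: "filter (\<lambda>l. l \<noteq> Suc h) [1..<m + 1] ! a = Suc (insert_index h a)"
      using nth_filter_neq_upt[of "Suc h" m a] h ab by simp
    have r: "filter (\<lambda>r. r \<noteq> 0) [1 - int j..int m - int j] ! b =
        int (Suc (insert_index (j - 1) b)) - int j"
      by (rule nth_filter_neq_upto) (use j ab in auto)
    have "insert_index h a < m" "insert_index (j - 1) b < m"
      using ab by (auto simp: insert_index_def)
    then show "rf_value (xiR (E (filter (\<lambda>l. l \<noteq> Suc h) [1..<m + 1] ! a))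
        (R (filter (\<lambda>l. l \<noteq> Suc h) [1..<m + 1] ! a))
        (filter (\<lambda>r. r \<noteq> 0) [1 - int j..int m - int j] ! b)
        (int m - int j - filter (\<lambda>r. r \<noteq> 0) [1 - int j..int m - int j] ! b)) (of_int x)
        (row_fun E R (insert_index h a) (x + int j - int (Suc (insert_index (j - 1) b)))
        / row_scale E (insert_index h a) (x + int j - int m))"
      unfolding l r by (intro rf_value_xiR reg) auto
  qed
  ultimately have D: "rf_value ?D (of_int x) (det (mat_delete ?F h (j - 1)))"
    by simp
  have xi: "rf_value (xi (E (Suc h)) (int m - int j)) (of_int x)
      (row_scale E h x / row_scale E h (x + int j - int m))"
    using rf_value_xi[OF reg[OF h], of "int m - int j" x] j
    by (simp add: row_scale_def algebra_simps)
  have shift: "rf_value (rf_shift (of_nat j) S) (of_int x) (s (x + int j))"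
    using S[OF j] by (intro rf_value_shift) simp
  have "Suc h + j = (h + (j - 1)) + 2" using j by simp
  then have sign: "(-1) ^ (Suc h + j) = ((-1) ^ (h + (j - 1)) :: 'a)" by (simp only: power_add) simp
  have "rf_value ((-1) ^ (Suc h + j)) (of_int x :: 'a) ((-1) ^ (Suc h + j))"
    by (rule rf_value_power[OF rf_value_minus_1])
  from rf_value_mult[OF rf_value_mult[OF rf_value_mult[OF this xi] shift] D]
  show "rf_value ((-1) ^ (Suc h + j) * xi (E (Suc h)) (int m - int j) * rf_shift (of_nat j) S * ?D)
      (of_int x) (row_scale E h x / row_scale E h (x + int j - int m) * s (x + int j) *
        cofactor ?F h (j - 1))"
    unfolding cofactor_def sign by (simp add: mult_ac)
qed

text \<open>The alternating signs in the top row of \<open>q\<^sub>n\<close> cancel the Laplace signs.\<close>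

lemma q_poly_expand:
  assumes reg: "\<And>a. a < m \<Longrightarrow> regular_on_ints (E (Suc a))"
  shows "q_poly m p E R n = (\<Sum>k\<le>m. Polynomial.smult
    (casorati_minor m (row_fun E R) (row_scale E) k (int n)) (pZ p (int n - int k)))"
proof -
  let ?C = "\<lambda>a j. row_fun E R a (int n - int j) / row_scale E a (int n - int m)"
  interpret const: comm_ring_hom "\<lambda>c::'a. [:c:]"
    by standard (simp_all add: one_pCons)
  have entry: "rf_eval (xi (E (Suc a)) (int m - int j)) (of_int (int n - int j))
      * poly (R (Suc a)) (of_int (int n - int j)) = ?C a j" if "a < m" "j \<le> m" for a j
    using rf_eval_eqI[OF rf_value_xi[OF reg[OF that(1)], of "int m - int j" "int n - int j"]] that(2)
    by (simp add: row_fun_def row_scale_def)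
  have "q_poly m p E R n = det (mat (Suc m) (Suc m) (\<lambda>(l, j).
      if l = 0 then (-1) ^ j * pZ p (int n - int j) else [:?C (l - 1) j:]))"
    unfolding q_poly_def
  proof (intro arg_cong[of _ _ det] eq_matI, goal_cases)
    case (1 l j)
    then show ?case using entry[of "l - 1" j] by (cases l) auto
  qed auto
  also have "\<dots> = (\<Sum>k\<le>m. (-1) ^ k * ((-1) ^ k * pZ p (int n - int k)) *
      det (mat m m (\<lambda>(a, b). [:?C a (insert_index k b):])))"
    by (rule det_border_row[of m _ "\<lambda>a j. [:?C a j:]"])
  also have "\<dots> = (\<Sum>k\<le>m. Polynomial.smult
      (casorati_minor m (row_fun E R) (row_scale E) k (int n)) (pZ p (int n - int k)))"
  proof (rule sum.cong[OF refl])
    fix k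
    let ?A = "casorati_mat m (row_fun E R) (row_scale E) (insert_index k) (int n)"
    have "mat m m (\<lambda>(a, b). [:?C a (insert_index k b):]) = map_mat (\<lambda>c. [:c:]) ?A"
      by (intro eq_matI) (auto simp: casorati_mat_def)
    moreover have "det (map_mat (\<lambda>c. [:c:]) ?A) = [:det ?A:]" by (rule const.hom_det)
    moreover have "(-1) ^ k * (-1) ^ k = (1 :: 'a poly)" by (simp flip: power_add mult_2)
    then have "(-1) ^ k * ((-1) ^ k * pZ p (int n - int k)) = pZ p (int n - int k)"
      by (simp flip: mult.assoc)
    ultimately show "(-1) ^ k * ((-1) ^ k * pZ p (int n - int k)) *
        det (mat m m (\<lambda>(a, b). [:?C a (insert_index k b):])) =
      Polynomial.smult (casorati_minor m (row_fun E R) (row_scale E) k (int n)) (pZ p (int n - int k))"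
      by (simp add: casorati_minor_def)
  qed
  finally show ?thesis .
qed

section \<open>Action of the operators\<close>

lemma linear_operator:
  assumes "Vector_Spaces.linear Polynomial.smult Polynomial.smult T"
  shows "T 0 = 0" "T (Polynomial.smult c f) = Polynomial.smult c (T f)"
    "T (sum F I) = (\<Sum>i\<in>I. T (F i))"
proof -
  interpret module_hom Polynomial.smult Polynomial.smult T
    using assms by (simp add: linear_iff_module_hom)
  show "T 0 = 0" "T (Polynomial.smult c f) = Polynomial.smult c (T f)"
    "T (sum F I) = (\<Sum>i\<in>I. T (F i))"
    by (rule zero scale sum)+
qed

lemma operator_algebraD:
  assumes "operator_algebra A"
  shows "T \<in> A \<Longrightarrow> Vector_Spaces.linear Polynomial.smult Polynomial.smult T"
    and "(\<lambda>f. f) \<in> A"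
    and "T \<in> A \<Longrightarrow> U \<in> A \<Longrightarrow> (\<lambda>f. T f + U f) \<in> A"
    and "T \<in> A \<Longrightarrow> (\<lambda>f. Polynomial.smult c (T f)) \<in> A"
    and "T \<in> A \<Longrightarrow> U \<in> A \<Longrightarrow> (\<lambda>f. T (U f)) \<in> A"
  using assms unfolding operator_algebra_def comp_def by blast+

lemma operator_algebra_sum:
  assumes A: "operator_algebra A" and "\<And>i. i \<in> I \<Longrightarrow> T i \<in> A"
  shows "(\<lambda>f. \<Sum>i\<in>I. T i f) \<in> A"
proof -
  have "(\<lambda>f. 0) \<in> A"
    using operator_algebraD(4)[OF A operator_algebraD(2)[OF A], of 0] by simp
  then show ?thesis
    using assms(2)
  proof (induction I rule: infinite_finite_induct)
    case (insert i I)
    then show ?case using operator_algebraD(3)[OF A, of "T i" "\<lambda>f. \<Sum>i\<in>I. T i f"] by simp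
  qed simp_all
qed

lemma poly_op_mem:
  assumes A: "operator_algebra A" and D: "D \<in> A"
  shows "poly_op P D \<in> A"
proof -
  have "(\<lambda>f. (D ^^ j) f) \<in> A" for j
  proof (induction j)
    case (Suc j)
    from operator_algebraD(5)[OF A D this] show ?case by simp
  qed (simp add: operator_algebraD(2)[OF A])
  then have "(\<lambda>f. Polynomial.smult (coeff P j) ((D ^^ j) f)) \<in> A" for j
    by (rule operator_algebraD(4)[OF A])
  then show ?thesis
    unfolding poly_op_def[abs_def] by (rule operator_algebra_sum[OF A])
qed

lemma poly_op_eigenvector:
  assumes lin: "Vector_Spaces.linear Polynomial.smult Polynomial.smult D"
    and D: "D f = Polynomial.smult c f"
  shows "poly_op P D f = Polynomial.smult (poly P c) f"
proof -
  have "(D ^^ j) f = Polynomial.smult (c ^ j) f" for j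
    by (induction j) (simp_all add: linear_operator[OF lin] D mult.commute)
  then show ?thesis
    by (simp add: poly_op_def poly_altdef smult_sum)
qed

text \<open>The convention \<open>p\<^sub>k = 0\<close> for \<open>k < 0\<close> is compatible with the eigenvalue equation of \<open>D\<^sub>p\<close>, so it holds
  for all integers \<open>k\<close>.\<close>

lemma poly_op_pZ:
  assumes lin: "Vector_Spaces.linear Polynomial.smult Polynomial.smult D"
    and D: "\<And>n. D (p n) = Polynomial.smult (of_nat n) (p n)"
  shows "poly_op P D (pZ p k) = Polynomial.smult (poly P (of_int k)) (pZ p k)"
  by (rule poly_op_eigenvector[OF lin]) (simp add: pZ_def D linear_operator[OF lin])

lemma pZ_int: "pZ p (int i) = p i"
  by (simp add: pZ_def)

text \<open>A \<open>\<D>\<close>-operator applied to \<open>p\<^bsub>n-k\<^esub>\<close>, with the products of \<open>\<epsilon>\<close>'s written as quotients and the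
  summation index \<open>u = k + j\<close> counted from \<open>n\<close>. Since \<open>p\<^bsub>n-u\<^esub> = 0\<close> for \<open>u > n\<close>, the upper
  bound \<open>N\<close> can be chosen uniformly in \<open>k\<close>, which allows exchanging sums.\<close>

lemma D_operator_pZ:
  assumes T: "D_operator A p eps T" and eps: "\<And>n. eps n = rf_eval e (of_nat n)"
    and reg: "regular_on_ints e" and N: "n \<le> N"
  shows "T (pZ p (int n - int k)) = (\<Sum>u\<in>{k+1..N}. Polynomial.smult
    ((-1) ^ (k + u + 1) * (rf_gauge e (int n - int k) / rf_gauge e (int n - int u)))
    (pZ p (int n - int u)))"
proof (cases "k \<le> n")
  case True
  have "T (p (n - k)) = (\<Sum>j=1..n - k. Polynomial.smult
      ((-1) ^ (j + 1) * (\<Prod>i<j. eps (n - k - i))) (p (n - k - j)))"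
    using T by (simp add: D_operator_def)
  also have "\<dots> = (\<Sum>u\<in>{k+1..n}. Polynomial.smult
      ((-1) ^ (k + u + 1) * (rf_gauge e (int n - int k) / rf_gauge e (int n - int u)))
      (pZ p (int n - int u)))"
  proof (rule sum.reindex_bij_witness[of _ "\<lambda>u. u - k" "\<lambda>j. k + j"], goal_cases)
    case (5 j)
    have "(\<Prod>i<j. eps (n - k - i)) = (\<Prod>i<j. rf_eval e (of_int (int n - int k - int i)))"
    proof (rule prod.cong[OF refl])
      fix i assume "i \<in> {..<j}"
      then have "int n - int k - int i = int (n - k - i)" using 5 by auto
      then show "eps (n - k - i) = rf_eval e (of_int (int n - int k - int i))"
        by (simp only: eps of_int_of_nat_eq)
    qed
    also have "\<dots> = rf_gauge e (int n - int k) / rf_gauge e (int n - int (k + j))"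
      using prod_rf_eval_eq_gauge[OF reg, where i = j and k = "int n - int k"]
      by (simp only: of_nat_add diff_diff_eq)
    finally have *: "(\<Prod>i<j. eps (n - k - i)) =
      rf_gauge e (int n - int k) / rf_gauge e (int n - int (k + j))" .
    have "int n - int (k + j) = int (n - k - j)" using 5 by auto
    then have "pZ p (int n - int (k + j)) = p (n - k - j)" by (simp only: pZ_int)
    moreover have "k + (k + j) + 1 = 2 * k + (j + 1)" by simp
    then have "(-1) ^ (k + (k + j) + 1) = ((-1) ^ (j + 1) :: 'a)"
      by (simp only: power_add[of _ "2 * k"] power_mult) simp
    ultimately show ?case unfolding * by simp
  qed (use True in auto)
  also have "\<dots> = (\<Sum>u\<in>{k+1..N}. Polynomial.smult
      ((-1) ^ (k + u + 1) * (rf_gauge e (int n - int k) / rf_gauge e (int n - int u)))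
      (pZ p (int n - int u)))"
    by (rule sum.mono_neutral_left) (use N in \<open>auto simp: pZ_def\<close>)
  finally have "T (p (n - k)) = \<dots>" .
  moreover have "pZ p (int n - int k) = p (n - k)"
    using pZ_int[of p "n - k"] True by (simp only: of_nat_diff)
  ultimately show ?thesis by (simp only:)
next
  case False
  have "T 0 = 0" using T by (simp add: D_operator_def linear_operator)
  with False show ?thesis by (simp add: pZ_def)
qed

lemma smult_sum_right: "Polynomial.smult c (sum F I) = (\<Sum>i\<in>I. Polynomial.smult c (F i))"
  by (induction I rule: infinite_finite_induct) (simp_all add: smult_add_right)

text \<open>In the double sum over \<open>k\<close> and \<open>u\<close> the weights factor into a part depending on \<open>k\<close> and a part
  depending on \<open>u\<close>. After the exchange, the coefficient of \<open>p\<^bsub>n-u\<^esub>\<close> contains a partial sum over \<open>k < u\<close>;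
  for \<open>u > m\<close> this is the full repeated-row sum and vanishes.\<close>

lemma D_operator_q_poly:
  fixes E :: "nat \<Rightarrow> 'a::field_char_0 poly fract" and Dp :: "'a poly \<Rightarrow> 'a poly"
  assumes reg: "\<And>a. a < m \<Longrightarrow> regular_on_ints (E (Suc a))"
    and A: "operator_algebra A" and Dp_mem: "Dp \<in> A"
    and Dp: "\<And>n. Dp (p n) = Polynomial.smult (of_nat n) (p n)"
    and T: "D_operator A p eps T" and eps: "\<And>n. eps n = rf_eval (E (Suc h)) (of_nat n)"
    and h: "h < m"
  shows "T (poly_op (R (Suc h)) Dp (q_poly m p E R n)) = (\<Sum>u\<le>m. Polynomial.smult
    ((-1) ^ (u + 1) / row_scale E h (int n - int u) *
      (\<Sum>k<u. (-1) ^ k * casorati_minor m (row_fun E R) (row_scale E) k (int n) * row_fun E R h (int n - int k)))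
    (pZ p (int n - int u)))"
proof -
  let ?b = "\<lambda>k. casorati_minor m (row_fun E R) (row_scale E) k (int n)"
  let ?P = "\<lambda>u. pZ p (int n - int u)"
  let ?f = "\<lambda>k. row_fun E R h (int n - int k)"
  let ?g = "\<lambda>u. row_scale E h (int n - int u)"
  have linT: "Vector_Spaces.linear Polynomial.smult Polynomial.smult T"
    using T by (simp add: D_operator_def)
  have linR: "Vector_Spaces.linear Polynomial.smult Polynomial.smult (poly_op (R (Suc h)) Dp)"
    by (rule operator_algebraD(1)[OF A poly_op_mem[OF A Dp_mem]])
  have "T (poly_op (R (Suc h)) Dp (q_poly m p E R n)) =
      (\<Sum>k\<le>m. Polynomial.smult (?b k * poly (R (Suc h)) (of_int (int n - int k))) (T (?P k)))"
    by (simp add: q_poly_expand[where E = E, OF reg] linear_operator[OF linT]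
        linear_operator[OF linR] poly_op_pZ[OF operator_algebraD(1)[OF A Dp_mem] Dp]
        del: of_int_diff)
  also have "\<dots> = (\<Sum>k\<le>m. \<Sum>u\<in>{k+1..n + m}. Polynomial.smult
      ((-1) ^ (u + 1) / ?g u * ((-1) ^ k * ?b k * ?f k)) (?P u))"
  proof -
    have "b * r * ((-1) ^ (k + u + 1) * (x / y)) = (-1) ^ (u + 1) / y * ((-1) ^ k * b * (x * r))"
      for b r x y :: 'a and k u :: nat
      by (simp add: power_add)
    then show ?thesis
      by (simp only: D_operator_pZ[OF T eps reg[OF h] le_add1[of n m]] smult_sum_right smult_smult
          row_fun_def row_scale_def)
  qed
  also have "\<dots> = (\<Sum>u\<le>n + m. \<Sum>k\<in>{k\<in>{..m}. k < u}. Polynomial.smult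
      ((-1) ^ (u + 1) / ?g u * ((-1) ^ k * ?b k * ?f k)) (?P u))"
  proof -
    have "{k+1..n + m} = {u\<in>{..n + m}. k < u}" for k by auto
    then show ?thesis
      by (simp only:) (rule sum.swap_restrict[OF finite_atMost finite_atMost])
  qed
  also have "\<dots> = (\<Sum>u\<le>n + m. Polynomial.smult
      ((-1) ^ (u + 1) / ?g u * (\<Sum>k\<in>{k\<in>{..m}. k < u}. (-1) ^ k * ?b k * ?f k)) (?P u))"
    by (simp only: sum_distrib_left smult_sum)
  also have "\<dots> = (\<Sum>u\<le>m. Polynomial.smult
      ((-1) ^ (u + 1) / ?g u * (\<Sum>k\<in>{k\<in>{..m}. k < u}. (-1) ^ k * ?b k * ?f k)) (?P u))"
  proof (rule sum.mono_neutral_right)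
    have "(\<Sum>k\<in>{k\<in>{..m}. k < u}. (-1) ^ k * ?b k * ?f k) = 0" if "u > m" for u
    proof -
      have "{k\<in>{..m}. k < u} = {..m}" using that by auto
      then show ?thesis
        using sum_casorati_minor_eq_0[OF h, of "row_scale E" "int n" "row_fun E R"]
          rf_gauge_nonzero[OF reg[OF h]] by (simp add: row_scale_def)
    qed
    then show "\<forall>u\<in>{..n + m} - {..m}. Polynomial.smult ((-1) ^ (u + 1) / ?g u *
        (\<Sum>k\<in>{k\<in>{..m}. k < u}. (-1) ^ k * ?b k * ?f k)) (?P u) = 0"
      by simp
  qed auto
  also have "\<dots> = (\<Sum>u\<le>m. Polynomial.smult
      ((-1) ^ (u + 1) / ?g u * (\<Sum>k<u. (-1) ^ k * ?b k * ?f k)) (?P u))"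
  proof (rule sum.cong[OF refl])
    fix u assume "u \<in> {..m}"
    then have "{k\<in>{..m}. k < u} = {..<u}" by auto
    then show "Polynomial.smult ((-1) ^ (u + 1) / ?g u *
        (\<Sum>k\<in>{k\<in>{..m}. k < u}. (-1) ^ k * ?b k * ?f k)) (?P u) =
      Polynomial.smult ((-1) ^ (u + 1) / ?g u * (\<Sum>k<u. (-1) ^ k * ?b k * ?f k)) (?P u)"
      by simp
  qed
  finally show ?thesis .
qed

section \<open>The eigenvalue equation\<close>

theorem theorem3p2:
  fixes A :: "('a::field_char_0 poly \<Rightarrow> 'a poly) set"
    and p :: "nat \<Rightarrow> 'a poly"
    and Dp :: "'a poly \<Rightarrow> 'a poly"
    and m :: nat
    and eps :: "nat \<Rightarrow> nat \<Rightarrow> 'a"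
    and E :: "nat \<Rightarrow> 'a poly fract"
    and Dop :: "nat \<Rightarrow> 'a poly \<Rightarrow> 'a poly"
    and R :: "nat \<Rightarrow> 'a poly"
    and S :: "'a poly fract"
    and M :: "nat \<Rightarrow> 'a poly"
    and P_S :: "'a poly"
  assumes alg: "operator_algebra A"
    and deg: "\<And>n. p n \<noteq> 0 \<and> degree (p n) = n"
    and Dp_mem: "Dp \<in> A"
    and Dp_p: "\<And>n. Dp (p n) = Polynomial.smult (of_nat n) (p n)"
    and m_ge: "m \<ge> 1"
    and Dop: "\<And>h. h \<in> {1..m} \<Longrightarrow> D_operator A p (eps h) (Dop h)"
    and eps_rational: "\<And>h n. h \<in> {1..m} \<Longrightarrow> eps h n = rf_eval (E h) (of_nat n)"
    and E_regular: "\<And>h k. h \<in> {1..m} \<Longrightarrow>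
          rf_defined_at (E h) (of_int k) \<and> rf_eval (E h) (of_int k) \<noteq> 0"
    and Omega_nz: "\<And>n::nat. rf_eval (Omega m E R) (of_nat n) \<noteq> 0"
    and S_Omega: "S * Omega m E R \<in> range to_fract"
    and M_poly: "\<And>h. h \<in> {1..m} \<Longrightarrow> Mfun m E R S h = to_fract (M h)"
    and P_S: "to_fract (P_S - pcompose P_S [:-1, 1:]) = S * Omega m E R"
  shows "D_qS m Dp Dop R M P_S \<in> A \<and>
    (\<forall>n. D_qS m Dp Dop R M P_S (q_poly m p E R n) = Polynomial.smult (poly P_S (of_nat n)) (q_poly m p E R n))"
proof
  have Dop_mem: "Dop h \<in> A" if "h \<in> {1..m}" for h
    using Dop[OF that] by (simp add: D_operator_def)
  show "D_qS m Dp Dop R M P_S \<in> A"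
    unfolding D_qS_def[abs_def]
  proof (rule operator_algebraD(3)[OF alg poly_op_mem[OF alg Dp_mem] operator_algebra_sum[OF alg]])
    fix h assume "h \<in> {1..m}"
    then have "Dop h \<in> A" by (rule Dop_mem)
    from operator_algebraD(5)[OF alg poly_op_mem[OF alg Dp_mem, of "M h"]
        operator_algebraD(5)[OF alg this poly_op_mem[OF alg Dp_mem, of "R h"]]]
    show "(\<lambda>f. poly_op (M h) Dp (Dop h (poly_op (R h) Dp f))) \<in> A" .
  qed
next
  let ?f = "row_fun E R" and ?g = "row_scale E"
  let ?\<omega> = "\<lambda>y. casorati_minor m ?f ?g 0 y"
  have reg: "regular_on_ints (E (Suc a))" if "a < m" for a
    using E_regular[of "Suc a"] that by (simp add: regular_on_ints_def)
  have g_nz: "?g a k \<noteq> 0" if "a < m" for a k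
    using rf_gauge_nonzero[OF reg[OF that]] by (simp add: row_scale_def)
  have Omega: "rf_value (Omega m E R) (of_int y) (?\<omega> y)" for y
    by (rule rf_value_Omega[where E = E, OF reg])
  have \<omega>_nz: "?\<omega> y \<noteq> 0" if "y \<ge> 0" for y
    using Omega_nz[of "nat y"] rf_eval_eqI[OF Omega, of y] that by simp
  \<comment> \<open>These are the values of \<open>S = S\<Omega> / \<Omega>\<close>. They exist at all integers \<open>y \<ge> 0\<close> because
    \<open>\<Omega>\<close> has no zero there; \<open>M\<^sub>h(n - u)\<close> with \<open>u \<le> n\<close> calls for \<open>S\<close> at positive integers only.\<close>
  define s where "s y = (poly P_S (of_int y) - poly P_S (of_int (y - 1))) / ?\<omega> y" for y
  have S: "rf_value S (of_int y) (s y)" if "y \<ge> 0" for y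
  proof -
    have "Omega m E R \<noteq> 0"
    proof
      assume "Omega m E R = 0"
      then have "rf_value 0 (of_int 0) (?\<omega> 0)" using Omega[of 0] by simp
      from rf_value_unique[OF this rf_value_0] show False using \<omega>_nz[of 0] by simp
    qed
    then have "S = to_fract (P_S - pcompose P_S [:-1, 1:]) / Omega m E R"
      using P_S by simp
    moreover have "rf_value (to_fract (P_S - pcompose P_S [:-1, 1:]) / Omega m E R) (of_int y)
        (poly (P_S - pcompose P_S [:-1, 1:]) (of_int y) / ?\<omega> y)"
      by (intro rf_value_divide rf_value_to_fract Omega \<omega>_nz that)
    ultimately show ?thesis by (simp add: s_def poly_pcompose)
  qed
  have lin: "Vector_Spaces.linear Polynomial.smult Polynomial.smult T" if "T \<in> A" for T
    by (rule operator_algebraD(1)[OF alg that])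
  note op_pZ = poly_op_pZ[OF lin[OF Dp_mem] Dp_p]
  note lin_op = linear_operator[OF lin[OF poly_op_mem[OF alg Dp_mem]]]
  show "\<forall>n. D_qS m Dp Dop R M P_S (q_poly m p E R n) =
    Polynomial.smult (poly P_S (of_nat n)) (q_poly m p E R n)"
  proof
    fix n
    let ?b = "\<lambda>k. casorati_minor m ?f ?g k (int n)"
    let ?P = "\<lambda>u. pZ p (int n - int u)"
    let ?t = "\<lambda>h u. (-1) ^ (u + 1) / ?g h (int n - int u) *
      (\<Sum>k<u. (-1) ^ k * ?b k * ?f h (int n - int k))"
    let ?M = "\<lambda>h u. poly (M (Suc h)) (of_int (int n - int u))"
    \<comment> \<open>The coefficient of \<open>p\<^bsub>n-u\<^esub>\<close>. For \<open>u > n\<close>, where \<open>S\<close> may have a pole at one of the points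
      involved, nothing has to be shown since \<open>p\<^bsub>n-u\<^esub> = 0\<close>.\<close>
    have coeff: "poly P_S (of_int (int n - int u)) * ?b u + (\<Sum>h<m. ?M h u * ?t h u) =
        poly P_S (of_nat n) * ?b u" if u: "u \<le> m" "u \<le> n" for u
    proof -
      define x where "x = int n - int u"
      have x: "x \<ge> 0" using u by (simp add: x_def)
      have M: "poly (M (Suc h)) (of_int x) = (\<Sum>j=1..m. ?g h x / ?g h (x + int j - int m) *
          s (x + int j) * cofactor (casorati_mat m ?f ?g Suc (x + int j)) h (j - 1))" if "h < m" for h
        using rf_value_unique[OF rf_value_to_fract, of "M (Suc h)" "of_int x"]
          rf_value_Mfun[of m E S x s h R, OF reg S that, simplified] M_poly[of "Suc h"] x that by simp
      have "(\<Sum>h<m. ?M h u * ?t h u) = (\<Sum>j=1..u. s (x + int j) * ?\<omega> (x + int j)) * ?b u"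
        using telescoped_sum_eq[OF g_nz u(1) x_def M] unfolding x_def by simp
      also have "(\<Sum>j=1..u. s (x + int j) * ?\<omega> (x + int j)) =
          (\<Sum>j=1..u. poly P_S (of_int (x + int j)) - poly P_S (of_int (x + int (j - 1))))"
      proof (rule sum.cong[OF refl])
        fix j assume "j \<in> {1..u}"
        then have "x + int j - 1 = x + int (j - 1)" "?\<omega> (x + int j) \<noteq> 0"
          using x \<omega>_nz[of "x + int j"] by auto
        then show "s (x + int j) * ?\<omega> (x + int j) =
            poly P_S (of_int (x + int j)) - poly P_S (of_int (x + int (j - 1)))"
          by (simp only: s_def times_divide_eq_left nonzero_mult_div_cancel_right not_False_eq_True)
      qed
      also have "\<dots> = poly P_S (of_int (x + int u)) - poly P_S (of_int x)"
        using sum_telescope''[of 0 u "\<lambda>j. poly P_S (of_int (x + int j))"] by simp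
      finally show ?thesis by (simp add: x_def algebra_simps)
    qed
    have "D_qS m Dp Dop R M P_S (q_poly m p E R n) = poly_op P_S Dp (q_poly m p E R n) +
        (\<Sum>h<m. poly_op (M (Suc h)) Dp
          (Dop (Suc h) (poly_op (R (Suc h)) Dp (q_poly m p E R n))))"
      unfolding D_qS_def by (simp add: sum.atLeast1_atMost_eq)
    also have "poly_op P_S Dp (q_poly m p E R n) =
        (\<Sum>u\<le>m. Polynomial.smult (poly P_S (of_int (int n - int u)) * ?b u) (?P u))"
      by (simp add: q_poly_expand[where E = E, OF reg] lin_op op_pZ mult.commute del: of_int_diff)
    also have "(\<Sum>h<m. poly_op (M (Suc h)) Dp
          (Dop (Suc h) (poly_op (R (Suc h)) Dp (q_poly m p E R n)))) =
        (\<Sum>h<m. poly_op (M (Suc h)) Dp (\<Sum>u\<le>m. Polynomial.smult (?t h u) (?P u)))"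
    proof (rule sum.cong[OF refl])
      fix h assume "h \<in> {..<m}"
      then have h: "h < m" "Suc h \<in> {1..m}" by auto
      show "poly_op (M (Suc h)) Dp (Dop (Suc h) (poly_op (R (Suc h)) Dp (q_poly m p E R n))) =
        poly_op (M (Suc h)) Dp (\<Sum>u\<le>m. Polynomial.smult (?t h u) (?P u))"
        using D_operator_q_poly[where E = E, OF reg alg Dp_mem Dp_p Dop[OF h(2)] eps_rational[OF h(2)] h(1)]
        by simp
    qed
    also have "\<dots> = (\<Sum>u\<le>m. Polynomial.smult (\<Sum>h<m. ?M h u * ?t h u) (?P u))"
      by (simp only: lin_op op_pZ smult_smult smult_sum mult.commute) (rule sum.swap)
    also have "(\<Sum>u\<le>m. Polynomial.smult (poly P_S (of_int (int n - int u)) * ?b u) (?P u)) +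
        (\<Sum>u\<le>m. Polynomial.smult (\<Sum>h<m. ?M h u * ?t h u) (?P u)) =
        (\<Sum>u\<le>m. Polynomial.smult (poly P_S (of_nat n) * ?b u) (?P u))"
      unfolding sum.distrib[symmetric] smult_add_left[symmetric]
    proof (rule sum.cong[OF refl])
      fix u assume "u \<in> {..m}"
      then show "Polynomial.smult (poly P_S (of_int (int n - int u)) * ?b u +
          (\<Sum>h<m. ?M h u * ?t h u)) (?P u) = Polynomial.smult (poly P_S (of_nat n) * ?b u) (?P u)"
        using coeff[of u] by (cases "u \<le> n") (simp_all add: pZ_def)
    qed
    also have "\<dots> = Polynomial.smult (poly P_S (of_nat n)) (q_poly m p E R n)"
      by (simp add: q_poly_expand[where E = E, OF reg] smult_sum_right)
    finally show "D_qS m Dp Dop R M P_S (q_poly m p E R n) =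
      Polynomial.smult (poly P_S (of_nat n)) (q_poly m p E R n)" .
  qed
qed

end
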